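(* Let $G=(V,E)$ be a finite graph with weighted or unweighted edges. If $A\subset V$ is a pinch cluster for $G$, then there is a strongly irreducible ordering $o$ of $V$ that discovers $A$, i.e. such that, writing $v_i=o^{-1}(i)$, one has $A=\{v_1,\dots,v_i\}$ for some local minimum $i$ of $o$.
   Context: $G=(V,E)$ is a finite graph in which each edge has distinct endpoints; edges carry non-negative weights (all equal to $1$ in the unweighted case). For $A\subset V$, the boundary $\partial A$ is the set of edges with one endpoint in $A$ and the other in $V\setminus A$, and its size $|\partial A|$ is the sum of the weights of these edges. Pinch cluster: a set $A\subset V$ such that for any sequence of vertices $w_1,\dots,w_m$, if adding $w_1,\dots,w_m$ to $A$ or removing $w_1,\dots,w_m$ from $A$ creates a set with smaller boundary (than that of $A$), then for some $k<m$, adding (respectively removing) $w_1,\dots,w_k$ to (from) $A$ creates a set with strictly larger boundary. Orderings: let $N=|V|$. An ordering of $V$ is a bijection $o:V\to[1,N]$, where $[1,N]$ denotes the integers from $1$ to $N$. Write $v_i=o^{-1}(i)$, $A_i=\{v_1,\dots,v_i\}$, and $b_i=|\partial A_i|$ (the width at level $i$). Let $a_{k,\ell}$ be the weight of the edge between $v_k$ and $v_\ell$ ($0$ if there is none). For $A\subset V$ and $v\in V$, the slope $s_A(v)$ is the sum of the weights of the edges from $v$ to vertices of $V\setminus A$ minus the sum of the weights of the edges from $v$ to vertices of $A$; write $s_{i,j}=s_{A_i}(v_j)$. Flats: a flat in an ordering $o$ is an interval of integers $F=[i,j]$ (possibly with $i=j$) such that $b_i=b_{i+1}=\cdots=b_j$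 but the widths at $i-1$ and $j+1$ are different from $b_i=b_j$. It is locally maximal if the widths at $i-1$ and $j+1$ are both lower than the width at any level in $F$, and locally minimal if the widths at $i-1$ and $j+1$ are both greater than the width at any level in $F$. A level $i\in[1,N]$ is a local minimum (maximum) if it is contained in a locally minimal (maximal) flat. Weak reducibility: let $[i,j]$ be a locally maximal flat of $o$, and let $[i^-,j^-]$ and $[i^+,j^+]$ be the unique locally minimal flats with $j^-<i$, $j<i^+$ such that there are no minima strictly between $j^-$ and $i^+$. The maximum $i$ is weakly reducible if for some $k$ with $j^-<k\le i^+$ one of the following holds: (1) $k\le i$, $s_{i,k}>0$ and $s_{i,k}-s_{i,i+1}-2a_{k,i+1}>0$; or (2) $k>j$, $s_{j,k}<0$ and $-s_{j,k}+s_{j,j}-2a_{k,j}>0$. A maximum that is not weakly reducible is strongly irreducible. An ordering is strongly irreducible if all its maxima are strongly irreducible. *)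

theory Defs
  imports Complex_Main
begin

text \<open>Edges are two-element sets of vertices. The unweighted case is \<open>w = (\<lambda>_. 1)\<close>.\<close>

locale weighted_graph =
  fixes V :: "'v set" and E :: "'v set set" and w :: "'v set \<Rightarrow> real"
  assumes finite_V: "finite V"
    and edges: "\<And>e. e \<in> E \<Longrightarrow> e \<subseteq> V \<and> card e = 2"
    and weight_nonneg: "\<And>e. e \<in> E \<Longrightarrow> 0 \<le> w e"
begin

definition boundary :: "'v set \<Rightarrow> 'v set set" where
  "boundary A = {e \<in> E. \<exists>u\<in>A. \<exists>v\<in>V - A. e = {u, v}}"

definition boundary_size :: "'v set \<Rightarrow> real" where
  "boundary_size A = (\<Sum>e\<in>boundary A. w e)"

definition pinch_cluster :: "'v set \<Rightarrow> bool" where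
  "pinch_cluster A \<longleftrightarrow> A \<subseteq> V \<and>
     (\<forall>ws. set ws \<subseteq> V \<longrightarrow>
        (boundary_size (A \<union> set ws) < boundary_size A \<longrightarrow>
           (\<exists>k<length ws. boundary_size A < boundary_size (A \<union> set (take k ws)))) \<and>
        (boundary_size (A - set ws) < boundary_size A \<longrightarrow>
           (\<exists>k<length ws. boundary_size A < boundary_size (A - set (take k ws)))))"

definition edge_weight :: "'v \<Rightarrow> 'v \<Rightarrow> real" where
  "edge_weight u v = (if {u, v} \<in> E then w {u, v} else 0)"

definition slope :: "'v set \<Rightarrow> 'v \<Rightarrow> real" where
  "slope A v = (\<Sum>u\<in>V - A. edge_weight v u) - (\<Sum>u\<in>A. edge_weight v u)"

definition ordering :: "('v \<Rightarrow> nat) \<Rightarrow> bool" where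
  "ordering ord \<longleftrightarrow> bij_betw ord V {1..card V}"

definition vert :: "('v \<Rightarrow> nat) \<Rightarrow> nat \<Rightarrow> 'v" where
  "vert ord i = inv_into V ord i"

definition initial :: "('v \<Rightarrow> nat) \<Rightarrow> nat \<Rightarrow> 'v set" where
  "initial ord i = vert ord ` {1..i}"

definition width :: "('v \<Rightarrow> nat) \<Rightarrow> nat \<Rightarrow> real" where
  "width ord i = boundary_size (initial ord i)"

definition level_slope :: "('v \<Rightarrow> nat) \<Rightarrow> nat \<Rightarrow> nat \<Rightarrow> real" where
  "level_slope ord i j = slope (initial ord i) (vert ord j)"

definition level_weight :: "('v \<Rightarrow> nat) \<Rightarrow> nat \<Rightarrow> nat \<Rightarrow> real" where
  "level_weight ord k l = edge_weight (vert ord k) (vert ord l)"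

text \<open>
  Levels run from \<open>0\<close> (the empty set) to \<open>card V\<close> (all of \<open>V\<close>). The levels \<open>-1\<close> and
  \<open>card V + 1\<close> do not exist and are treated as if they had infinite width. Both end flats, which
  have width \<open>0\<close>, are thus locally minimal and never locally maximal, so that every locally
  maximal flat has a locally minimal flat on either side
  (lemma \<open>flanking_minima_unique_exist\<close>).
\<close>

definition flat :: "('v \<Rightarrow> nat) \<Rightarrow> nat \<Rightarrow> nat \<Rightarrow> bool" where
  "flat ord i j \<longleftrightarrow> i \<le> j \<and> j \<le> card V \<and>
     (\<forall>m\<in>{i..j}. width ord m = width ord i) \<and>
     (0 < i \<longrightarrow> width ord (i - 1) \<noteq> width ord i) \<and>
     (j < card V \<longrightarrow> width ord (j + 1) \<noteq> width ord j)"

definition max_flat :: "('v \<Rightarrow> nat) \<Rightarrow> nat \<Rightarrow> nat \<Rightarrow> bool" where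
  "max_flat ord i j \<longleftrightarrow> flat ord i j \<and>
     0 < i \<and> width ord (i - 1) < width ord i \<and>
     j < card V \<and> width ord (j + 1) < width ord j"

definition min_flat :: "('v \<Rightarrow> nat) \<Rightarrow> nat \<Rightarrow> nat \<Rightarrow> bool" where
  "min_flat ord i j \<longleftrightarrow> flat ord i j \<and>
     (0 < i \<longrightarrow> width ord (i - 1) > width ord i) \<and>
     (j < card V \<longrightarrow> width ord (j + 1) > width ord j)"

definition local_min :: "('v \<Rightarrow> nat) \<Rightarrow> nat \<Rightarrow> bool" where
  "local_min ord m \<longleftrightarrow> (\<exists>i j. min_flat ord i j \<and> i \<le> m \<and> m \<le> j)"

definition flanking_minima ::
    "('v \<Rightarrow> nat) \<Rightarrow> nat \<Rightarrow> nat \<Rightarrow> nat \<Rightarrow> nat \<Rightarrow> nat \<Rightarrow> nat \<Rightarrow> bool" where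
  "flanking_minima ord i j im jm ip jp \<longleftrightarrow>
     min_flat ord im jm \<and> min_flat ord ip jp \<and> jm < i \<and> j < ip \<and>
     (\<forall>m. jm < m \<and> m < ip \<longrightarrow> \<not> local_min ord m)"

definition weakly_reducible :: "('v \<Rightarrow> nat) \<Rightarrow> nat \<Rightarrow> nat \<Rightarrow> bool" where
  "weakly_reducible ord i j \<longleftrightarrow> max_flat ord i j \<and>
     (\<exists>im jm ip jp. flanking_minima ord i j im jm ip jp \<and>
       (\<exists>k. jm < k \<and> k \<le> ip \<and>
         (k \<le> i \<and> level_slope ord i k > 0 \<and>
            level_slope ord i k - level_slope ord i (i + 1) - 2 * level_weight ord k (i + 1) > 0 \<or>
          k > j \<and> level_slope ord j k < 0 \<and>
            - level_slope ord j k + level_slope ord j j - 2 * level_weight ord k j > 0)))"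

definition strongly_irreducible :: "('v \<Rightarrow> nat) \<Rightarrow> bool" where
  "strongly_irreducible ord \<longleftrightarrow>
     (\<forall>i j. max_flat ord i j \<longrightarrow> \<not> weakly_reducible ord i j)"

definition discovers :: "('v \<Rightarrow> nat) \<Rightarrow> 'v set \<Rightarrow> bool" where
  "discovers ord A \<longleftrightarrow> (\<exists>i. local_min ord i \<and> A = initial ord i)"

lemma boundary_size_nonneg: "0 \<le> boundary_size A"
  unfolding boundary_size_def boundary_def by (rule sum_nonneg) (simp add: weight_nonneg)

lemma width_0: "width ord 0 = 0"
  by (simp add: width_def initial_def boundary_size_def boundary_def)

lemma width_card: "ordering ord \<Longrightarrow> width ord (card V) = 0"
proof -
  assume "ordering ord"
  then have "initial ord (card V) = V"
    using bij_betw_imp_surj_on[OF bij_betw_inv_into]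
    by (fastforce simp: ordering_def initial_def vert_def)
  then show ?thesis
    by (simp add: width_def boundary_size_def boundary_def)
qed

lemma flat_unique:
  assumes "flat ord i j" "flat ord i' j'" "i \<le> m" "m \<le> j" "i' \<le> m" "m \<le> j'"
  shows "i = i' \<and> j = j'"
proof -
  have *: "i' \<le> i \<and> j \<le> j'"
    if F: "flat ord i j" "flat ord i' j'" "i \<le> m" "m \<le> j" "i' \<le> m" "m \<le> j'" for i j i' j'
  proof (intro conjI; rule ccontr)
    assume "\<not> i' \<le> i"
    then have "i' \<in> {i..j}" "i' - 1 \<in> {i..j}" "0 < i'"
      using F by auto
    then show False
      using F(1,2) unfolding flat_def by metis
  next
    assume "\<not> j \<le> j'"
    then have "j' \<in> {i..j}" "j' + 1 \<in> {i..j}" "j' < card V"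
      using F(3-6) F(1)[unfolded flat_def] by auto
    then show False
      using F(1,2) unfolding flat_def by metis
  qed
  show ?thesis
    using *[of i j i' j'] *[of i' j' i j] assms by force
qed

lemma local_min_0: "local_min ord 0"
proof -
  let ?P = "\<lambda>q. q \<le> card V \<and> (\<forall>m\<in>{0..q}. width ord m = 0)"
  have "?P 0" by (simp add: width_0)
  then obtain q where q: "?P q" "\<And>r. ?P r \<Longrightarrow> r \<le> q"
    using Nat.ex_has_greatest_nat[of ?P 0 "card V"] by auto
  have "width ord (q + 1) > width ord q" if "q < card V"
  proof -
    have "\<not> ?P (q + 1)" using q(2)[of "q + 1"] by auto
    then have "width ord (q + 1) \<noteq> 0"
      using q(1) that by (auto simp: le_Suc_eq)
    then show ?thesis
      using q(1) boundary_size_nonneg[of "initial ord (q + 1)"] by (simp add: width_def)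
  qed
  then have "min_flat ord 0 q"
    using q(1) unfolding min_flat_def flat_def by (force simp: width_0)
  then show ?thesis unfolding local_min_def by blast
qed

lemma local_min_card: assumes "ordering ord" shows "local_min ord (card V)"
proof -
  let ?P = "\<lambda>q. q \<le> card V \<and> (\<forall>m\<in>{q..card V}. width ord m = 0)"
  have "?P (card V)" by (simp add: width_card[OF assms])
  then obtain q where q: "?P q" "\<And>r. ?P r \<Longrightarrow> q \<le> r"
    using LeastI[of ?P] Least_le[of ?P] by blast
  have "width ord (q - 1) > width ord q" if "0 < q"
  proof -
    have "\<not> ?P (q - 1)" using q(2)[of "q - 1"] that by fastforce
    moreover have "m = q - 1 \<or> m \<in> {q..card V}" if "m \<in> {q - 1..card V}" for m
      using that by auto
    ultimately have "width ord (q - 1) \<noteq> 0"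
      using q(1) by (metis diff_le_self order_trans)
    then show ?thesis
      using q(1) boundary_size_nonneg[of "initial ord (q - 1)"] by (simp add: width_def)
  qed
  then have "min_flat ord q (card V)"
    using q(1) unfolding min_flat_def flat_def by force
  then show ?thesis
    using q(1) unfolding local_min_def by blast
qed

lemma flanking_minima_unique_exist:
  assumes "ordering ord" "max_flat ord i j"
  shows "\<exists>!(im, jm, ip, jp). flanking_minima ord i j im jm ip jp"
proof -
  have ij: "0 < i" "i \<le> j" "j < card V" "flat ord i j"
    "width ord (i - 1) < width ord i" "width ord (j + 1) < width ord j"
    using assms(2) unfolding max_flat_def flat_def by blast+
  have inside: "\<not> local_min ord m" if "i \<le> m" "m \<le> j" for m
  proof
    assume "local_min ord m"
    then obtain i' j' where "min_flat ord i' j'" "i' \<le> m" "m \<le> j'"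
      unfolding local_min_def by blast
    then show False
      using flat_unique[of ord i j i' j' m] ij that unfolding min_flat_def by auto
  qed
  have end_j: "local_min ord j'" and end_i: "local_min ord i'" if "min_flat ord i' j'" for i' j'
    using that unfolding local_min_def min_flat_def flat_def by (meson order_refl)+
  have min_le: "j' \<le> card V" "i' \<le> j'" if "min_flat ord i' j'" for i' j'
    using that unfolding min_flat_def flat_def by blast+
  have minunique: "i1 = i2 \<and> j1 = j2"
    if "min_flat ord i1 j1" "min_flat ord i2 j2" "i1 \<le> m" "m \<le> j1" "i2 \<le> m" "m \<le> j2"
    for i1 j1 i2 j2 m
    using that flat_unique unfolding min_flat_def by blast
  obtain l where l: "local_min ord l" "l < i" "\<And>m. local_min ord m \<Longrightarrow> m < i \<Longrightarrow> m \<le> l"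
    using Nat.ex_has_greatest_nat[of "\<lambda>m. local_min ord m \<and> m < i" 0 i] local_min_0 ij(1)
    by auto
  obtain r where r: "local_min ord r" "j < r" "\<And>m. local_min ord m \<Longrightarrow> j < m \<Longrightarrow> r \<le> m"
    using LeastI[of "\<lambda>m. local_min ord m \<and> j < m"] Least_le[of "\<lambda>m. local_min ord m \<and> j < m"]
      local_min_card[OF assms(1)] ij(3)
    by blast
  obtain im jm where L: "min_flat ord im jm" "im \<le> l" "l \<le> jm"
    using l(1) unfolding local_min_def by blast
  obtain ip jp where R: "min_flat ord ip jp" "ip \<le> r" "r \<le> jp"
    using r(1) unfolding local_min_def by blast
  have "jm < i"
  proof (rule ccontr)
    assume "\<not> jm < i"
    then have "local_min ord i" using L l(2) unfolding local_min_def
      by (meson le_trans less_imp_le not_le)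
    then show False using inside ij(2) by blast
  qed
  have "j < ip"
  proof (rule ccontr)
    assume "\<not> j < ip"
    then have "local_min ord j" using R r(2) unfolding local_min_def
      by (meson le_trans less_imp_le not_le)
    then show False using inside ij(2) by blast
  qed
  have jm: "jm = l" using l(3)[OF end_j[OF L(1)] \<open>jm < i\<close>] L(3) by simp
  have ip: "ip = r" using r(3)[OF end_i[OF R(1)] \<open>j < ip\<close>] R(2) by simp
  have "\<not> local_min ord m" if "jm < m" "m < ip" for m
    using inside[of m] l(3)[of m] r(3)[of m] that jm ip by (meson not_le)
  then have ex: "flanking_minima ord i j im jm ip jp"
    unfolding flanking_minima_def using L(1) R(1) \<open>jm < i\<close> \<open>j < ip\<close> by blast
  have uniq: "im' = im \<and> jm' = jm \<and> ip' = ip \<and> jp' = jp"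
    if "flanking_minima ord i j im' jm' ip' jp'" for im' jm' ip' jp'
  proof -
    have f: "min_flat ord im' jm'" "min_flat ord ip' jp'" "jm' < i" "j < ip'"
      "\<And>m. jm' < m \<Longrightarrow> m < ip' \<Longrightarrow> \<not> local_min ord m"
      using that unfolding flanking_minima_def by auto
    have "jm' = l"
      using l(3)[OF end_j[OF f(1)] f(3)] f(5)[of l] l(1,2) f(4) ij(2) by force
    moreover have "ip' = r"
      using r(3)[OF end_i[OF f(2)] f(4)] f(5)[of r] r(1,2) f(3) ij(2) by force
    ultimately show ?thesis
      using minunique[OF f(1) L(1), of l] minunique[OF f(2) R(1), of r] jm ip
        min_le[OF f(1)] min_le[OF f(2)] min_le[OF L(1)] min_le[OF R(1)] by auto
  qed
  show ?thesis
  proof (rule ex1I[of _ "(im, jm, ip, jp)"])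
    fix x
    assume *: "case x of (im, jm, ip, jp) \<Rightarrow> flanking_minima ord i j im jm ip jp"
    obtain im' jm' ip' jp' where x: "x = (im', jm', ip', jp')"
      by (cases x) blast
    with * have "flanking_minima ord i j im' jm' ip' jp'"
      by simp
    from uniq[OF this] show "x = (im, jm, ip, jp)"
      by (simp add: x)
  qed (simp add: ex)
qed

end

end

theory Submission
  imports Defs
begin

text \<open>
  A pinch cluster \<open>A\<close> is a local minimum of \<^emph>\<open>every\<close> ordering that has \<open>A\<close> as an initial segment:
  leaving the flat around \<open>A\<close> downwards would contradict the pinch condition. Among these orderings,
  minimise the multiset of widths in the multiset order. A weak reduction moves one
  vertex past a maximum; it changes only sets strictly between two consecutive minima, so it keeps
  \<open>A\<close>, and by submodularity each new width is below some width that it replaces. Hence a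
  minimiser admits no weak reduction.
\<close>

context weighted_graph
begin

subsection \<open>Boundary size and slopes\<close>

lemma edge_weight_commute: "edge_weight u v = edge_weight v u"
  by (simp add: edge_weight_def insert_commute)

lemma edge_weight_same: "edge_weight v v = 0"
  using edges[of "{v, v}"] by (auto simp: edge_weight_def)

lemma edge_weight_nonneg: "0 \<le> edge_weight u v"
  using weight_nonneg by (simp add: edge_weight_def)

text \<open>Each boundary edge has exactly one orientation from \<open>S\<close> to
  \<open>V - S\<close>, so edges correspond to pairs in \<open>?P\<close>. The other pairs of
  \<open>S \<times> (V - S)\<close> have \<open>edge_weight\<close> 0 and may be added
  freely.\<close>

lemma boundary_size_eq_cut:
  assumes "S \<subseteq> V"
  shows "boundary_size S = (\<Sum>u\<in>S. \<Sum>v\<in>V - S. edge_weight u v)"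
proof -
  let ?P = "{(u, v). u \<in> S \<and> v \<in> V - S \<and> {u, v} \<in> E}"
  have fin: "finite S" using assms finite_V finite_subset by blast
  have inj: "inj_on (\<lambda>(u, v). {u, v}) ?P"
    by (auto simp: inj_on_def doubleton_eq_iff)
  have "boundary S = (\<lambda>(u, v). {u, v}) ` ?P"
    by (auto simp: boundary_def image_iff)
  then have "boundary_size S = (\<Sum>(u, v)\<in>?P. edge_weight u v)"
    unfolding boundary_size_def
    by (simp only: sum.reindex[OF inj]) (auto simp: edge_weight_def intro!: sum.cong)
  also have "\<dots> = (\<Sum>(u, v)\<in>S \<times> (V - S). edge_weight u v)"
    using fin finite_V by (intro sum.mono_neutral_left) (auto simp: edge_weight_def split: if_splits)
  finally show ?thesis by (simp add: sum.cartesian_product)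
qed

text \<open>When \<open>u\<close> changes sides, the weight between \<open>v\<close> and
  \<open>u\<close> leaves the positive sum and enters the negative one, hence the factor 2. The case
  \<open>v = u\<close> is covered, as there are no loops.\<close>

lemma slope_insert:
  assumes "u \<in> V - S" "S \<subseteq> V"
  shows "slope (insert u S) v = slope S v - 2 * edge_weight v u"
proof -
  have "finite S" using assms finite_V finite_subset by blast
  then have "(\<Sum>x\<in>insert u S. edge_weight v x) = edge_weight v u + (\<Sum>x\<in>S. edge_weight v x)"
    using assms by simp
  moreover have "V - S = insert u (V - insert u S)" using assms by auto
  then have "(\<Sum>x\<in>V - S. edge_weight v x) = edge_weight v u + (\<Sum>x\<in>V - insert u S. edge_weight v x)"
    using finite_V by (metis Diff_iff finite_Diff insertI1 sum.insert)
  ultimately show ?thesis unfolding slope_def by linarith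
qed

lemma slope_insert_self: "v \<in> V - S \<Longrightarrow> S \<subseteq> V \<Longrightarrow> slope (insert v S) v = slope S v"
  by (simp add: slope_insert edge_weight_same)

text \<open>Since the slope is the change of boundary size on adding a vertex, this is the
  submodularity of the cut function.\<close>

lemma slope_antimono:
  assumes "S \<subseteq> T" "T \<subseteq> V"
  shows "slope T v \<le> slope S v"
proof -
  have "finite T" using assms finite_V finite_subset by blast
  then have "(\<Sum>u\<in>S. edge_weight v u) \<le> (\<Sum>u\<in>T. edge_weight v u)"
    using assms by (intro sum_mono2) (auto simp: edge_weight_nonneg)
  moreover have "(\<Sum>u\<in>V - T. edge_weight v u) \<le> (\<Sum>u\<in>V - S. edge_weight v u)"
    using assms finite_V by (intro sum_mono2) (auto simp: edge_weight_nonneg)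
  ultimately show ?thesis by (simp add: slope_def)
qed

text \<open>The edges from \<open>S\<close> to \<open>W\<close>, the vertices outside both
  \<open>S\<close> and \<open>v\<close>, are cut before and after. Only the edges at
  \<open>v\<close> change status, and their net contribution is the slope.\<close>

lemma boundary_size_insert:
  assumes "v \<in> V - S" "S \<subseteq> V"
  shows "boundary_size (insert v S) = boundary_size S + slope S v"
proof -
  have fin: "finite S" using assms finite_V finite_subset by blast
  define W where "W = V - insert v S"
  have W: "V - S = insert v W" "v \<notin> W" "finite W"
    using assms finite_V by (auto simp: W_def)
  have "boundary_size (insert v S) =
      (\<Sum>x\<in>W. edge_weight v x) + (\<Sum>u\<in>S. \<Sum>x\<in>W. edge_weight u x)"
    using assms fin by (subst boundary_size_eq_cut) (auto simp: W_def)
  moreover have "boundary_size S =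
      (\<Sum>u\<in>S. edge_weight v u) + (\<Sum>u\<in>S. \<Sum>x\<in>W. edge_weight u x)"
    using assms W by (simp add: boundary_size_eq_cut sum.distrib edge_weight_commute[of _ v])
  moreover have "slope S v = (\<Sum>x\<in>W. edge_weight v x) - (\<Sum>u\<in>S. edge_weight v u)"
    using W by (simp add: slope_def edge_weight_same)
  ultimately show ?thesis by simp
qed

lemma boundary_size_remove:
  assumes "v \<in> S" "S \<subseteq> V"
  shows "boundary_size (S - {v}) = boundary_size S - slope S v"
proof -
  have "v \<in> V - (S - {v})" "S - {v} \<subseteq> V" "insert v (S - {v}) = S" using assms by auto
  then show ?thesis
    using boundary_size_insert[of v "S - {v}"] slope_insert_self[of v "S - {v}"] by simp
qed

subsection \<open>Orderings and their initial segments\<close>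

lemma vert_in: "ordering ord \<Longrightarrow> 1 \<le> m \<Longrightarrow> m \<le> card V \<Longrightarrow> vert ord m \<in> V"
  unfolding ordering_def vert_def by (metis atLeastAtMost_iff bij_betw_imp_surj_on inv_into_into)

lemma ord_vert: "ordering ord \<Longrightarrow> 1 \<le> m \<Longrightarrow> m \<le> card V \<Longrightarrow> ord (vert ord m) = m"
  unfolding ordering_def vert_def by (simp add: bij_betw_inv_into_right)

lemma vert_ord: "ordering ord \<Longrightarrow> v \<in> V \<Longrightarrow> vert ord (ord v) = v"
  unfolding ordering_def vert_def by (simp add: bij_betw_inv_into_left)

lemma ord_bounds: "ordering ord \<Longrightarrow> v \<in> V \<Longrightarrow> 1 \<le> ord v \<and> ord v \<le> card V"
  unfolding ordering_def using bij_betwE by fastforce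

lemma ord_eq_iff:
  "ordering ord \<Longrightarrow> v \<in> V \<Longrightarrow> 1 \<le> m \<Longrightarrow> m \<le> card V \<Longrightarrow> ord v = m \<longleftrightarrow> v = vert ord m"
  using ord_vert vert_ord by metis

lemma initial_eq:
  assumes "ordering ord" "m \<le> card V"
  shows "initial ord m = {v \<in> V. ord v \<le> m}"
proof
  show "initial ord m \<subseteq> {v \<in> V. ord v \<le> m}"
    using assms by (auto simp: initial_def vert_in ord_vert)
  show "{v \<in> V. ord v \<le> m} \<subseteq> initial ord m"
  proof
    fix v assume "v \<in> {v \<in> V. ord v \<le> m}"
    then have "v = vert ord (ord v)" "ord v \<in> {1..m}"
      using assms vert_ord ord_bounds by auto
    then show "v \<in> initial ord m" unfolding initial_def by (rule image_eqI)
  qed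
qed

lemma initial_subset: "ordering ord \<Longrightarrow> m \<le> card V \<Longrightarrow> initial ord m \<subseteq> V"
  by (auto simp: initial_eq)

lemma initial_mono: "l \<le> m \<Longrightarrow> initial ord l \<subseteq> initial ord m"
  by (auto simp: initial_def)

lemma initial_Suc: "initial ord (Suc m) = insert (vert ord (Suc m)) (initial ord m)"
  by (simp add: initial_def atLeastAtMostSuc_conv)

lemma ordering_through_exists:
  assumes "A \<subseteq> V"
  shows "\<exists>ord. ordering ord \<and> initial ord (card A) = A"
proof -
  have fin: "finite A" "finite (V - A)"
    using finite_subset[OF assms finite_V] finite_V by simp_all
  have card: "card (V - A) = card V - card A" using fin(1) assms by (rule card_Diff_subset)
  have le: "card A \<le> card V" using finite_V assms by (rule card_mono)
  obtain f where f: "bij_betw f A {1..card A}"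
    using finite_same_card_bij[OF fin(1), of "{1..card A}"] by auto
  obtain g where g: "bij_betw g (V - A) {card A + 1..card V}"
    using finite_same_card_bij[OF fin(2), of "{card A + 1..card V}"] card by auto
  define ord where "ord v = (if v \<in> A then f v else g v)" for v
  have "bij_betw ord A {1..card A}"
    using f by (subst bij_betw_cong[where g = f]) (auto simp: ord_def)
  moreover have "bij_betw ord (V - A) {card A + 1..card V}"
    using g by (subst bij_betw_cong[where g = g]) (auto simp: ord_def)
  ultimately have "bij_betw ord (A \<union> (V - A)) ({1..card A} \<union> {card A + 1..card V})"
    by (rule bij_betw_combine) auto
  moreover have "A \<union> (V - A) = V" "{1..card A} \<union> {card A + 1..card V} = {1..card V}"
    using assms le by auto
  ultimately have ord: "ordering ord" by (simp add: ordering_def)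
  have "ord v \<le> card A \<longleftrightarrow> v \<in> A" if "v \<in> V" for v
  proof (cases "v \<in> A")
    case True
    then show ?thesis using bij_betwE[OF f] by (simp add: ord_def)
  next
    case False
    then have "g v \<in> {card A + 1..card V}" using bij_betwE[OF g] that by blast
    then show ?thesis using False by (simp add: ord_def)
  qed
  then have "initial ord (card A) = A"
    using assms unfolding initial_eq[OF ord le] by blast
  then show ?thesis using ord by blast
qed

subsection \<open>Pinch clusters are local minima\<close>

text \<open>Add to the cluster the vertices at positions \<open>a + 1\<close> to
  \<open>q + 1\<close> in order. Every proper prefix stays on the levels \<open>a\<close> to
  \<open>q\<close> of constant width, so no intermediate set has larger boundary, and the pinch
  condition forbids a drop at the end.\<close>

lemma pinch_cluster_leaves_upwards:
  assumes ord: "ordering ord" and pinch: "pinch_cluster (initial ord a)"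
    and a: "a \<le> q" "q < card V" and const: "\<forall>m\<in>{a..q}. width ord m = width ord a"
  shows "width ord a \<le> width ord (q + 1)"
proof (rule ccontr)
  assume less: "\<not> width ord a \<le> width ord (q + 1)"
  define ws where "ws = map (vert ord) [a + 1..<q + 2]"
  have len: "length ws = q + 1 - a" by (simp add: ws_def del: upt_Suc)
  have add: "initial ord a \<union> set (take n ws) = initial ord (a + n)" if "n \<le> q + 1 - a" for n
  proof -
    have "take n ws = map (vert ord) [a + 1..<a + 1 + n]"
      using that a by (simp add: ws_def take_map take_upt del: upt_Suc)
    moreover have "{1..a} \<union> {a + 1..<a + 1 + n} = {1..a + n}" by auto
    ultimately show ?thesis
      by (simp add: initial_def del: upt_Suc flip: image_Un)
  qed
  have "set ws \<subseteq> V"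
    using a vert_in[OF ord] by (auto simp: ws_def)
  moreover have "boundary_size (initial ord a \<union> set ws) < boundary_size (initial ord a)"
    using add[of "q + 1 - a"] less a len by (simp add: width_def)
  ultimately obtain n where n: "n < length ws"
    "boundary_size (initial ord a) < boundary_size (initial ord a \<union> set (take n ws))"
    using pinch unfolding pinch_cluster_def by blast
  then have "width ord a < width ord (a + n)"
    using add[of n] len by (simp add: width_def)
  moreover have "a + n \<in> {a..q}" using n(1) len by simp
  then have "width ord (a + n) = width ord a" using const by blast
  ultimately show False by simp
qed

lemma pinch_cluster_leaves_downwards:
  assumes ord: "ordering ord" and pinch: "pinch_cluster (initial ord a)"
    and p: "0 < p" "p \<le> a" "a \<le> card V" and const: "\<forall>m\<in>{p..a}. width ord m = width ord a"
  shows "width ord a \<le> width ord (p - 1)"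
proof (rule ccontr)
  assume less: "\<not> width ord a \<le> width ord (p - 1)"
  \<comment> \<open>The positions are listed downwards from \<open>a\<close> to \<open>p\<close>, so
    that removing the first \<open>n\<close> entries yields the initial segment at level
    \<open>a - n\<close>.\<close>
  define ws where "ws = map (\<lambda>n. vert ord (a - n)) [0..<a + 1 - p]"
  have len: "length ws = a + 1 - p" by (simp add: ws_def)
  have remove: "initial ord a - set (take n ws) = initial ord (a - n)" if "n \<le> a + 1 - p" for n
  proof -
    have "set (take n ws) = (\<lambda>n. vert ord (a - n)) ` {0..<n}"
      using that by (simp add: ws_def take_map take_upt del: upt_Suc)
    also have "\<dots> = vert ord ` {a - n<..a}"
    proof -
      have "{a - n<..a} \<subseteq> (\<lambda>n. a - n) ` {0..<n}"
      proof
        fix x assume "x \<in> {a - n<..a}"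
        then have "x = a - (a - x)" "a - x \<in> {0..<n}" by auto
        then show "x \<in> (\<lambda>n. a - n) ` {0..<n}" by (rule image_eqI)
      qed
      moreover have "(\<lambda>n. a - n) ` {0..<n} \<subseteq> {a - n<..a}" using that p(1) by auto
      ultimately have "{a - n<..a} = (\<lambda>n. a - n) ` {0..<n}" by blast
      then show ?thesis by (simp add: image_image)
    qed
    also have "\<dots> = {v \<in> V. a - n < ord v \<and> ord v \<le> a}"
    proof
      show "vert ord ` {a - n<..a} \<subseteq> {v \<in> V. a - n < ord v \<and> ord v \<le> a}"
        using ord p(3) by (auto simp: vert_in ord_vert)
      show "{v \<in> V. a - n < ord v \<and> ord v \<le> a} \<subseteq> vert ord ` {a - n<..a}"
        using vert_ord[OF ord] by (force simp: image_iff)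
    qed
    finally have "set (take n ws) = {v \<in> V. a - n < ord v \<and> ord v \<le> a}" .
    moreover have "initial ord a = {v \<in> V. ord v \<le> a}"
        "initial ord (a - n) = {v \<in> V. ord v \<le> a - n}"
      using p(3) by (simp_all add: initial_eq[OF ord])
    ultimately show ?thesis by (simp only:) auto
  qed
  have "set ws \<subseteq> V"
    using p vert_in[OF ord] by (auto simp: ws_def)
  moreover have "boundary_size (initial ord a - set ws) < boundary_size (initial ord a)"
    using remove[of "a + 1 - p"] less p len by (simp add: width_def)
  ultimately obtain n where n: "n < length ws"
    "boundary_size (initial ord a) < boundary_size (initial ord a - set (take n ws))"
    using pinch unfolding pinch_cluster_def by blast
  then have "width ord a < width ord (a - n)"
    using remove[of n] len by (simp add: width_def)
  moreover have "a - n \<in> {p..a}" using n(1) len p by simp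
  then have "width ord (a - n) = width ord a" using const by blast
  ultimately show False by simp
qed

text \<open>Take the longest run of levels \<open>p\<close> to \<open>q\<close> around
  \<open>a\<close> with constant width. Just outside it the width differs by maximality and is not
  lower by the two preceding lemmas, so it is greater. An end at level 0 or \<open>card V\<close>
  imposes no condition.\<close>

lemma pinch_cluster_local_min:
  assumes ord: "ordering ord" and pinch: "pinch_cluster (initial ord a)" and a: "a \<le> card V"
  shows "local_min ord a"
proof -
  define b where "b = width ord a"
  let ?Q = "\<lambda>q. a \<le> q \<and> q \<le> card V \<and> (\<forall>m\<in>{a..q}. width ord m = b)"
  have "?Q a" using a by (simp add: b_def)
  then obtain q where q: "?Q q" "\<And>r. ?Q r \<Longrightarrow> r \<le> q"
    using Nat.ex_has_greatest_nat[of ?Q a "card V"] by blast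
  let ?P = "\<lambda>p. p \<le> a \<and> (\<forall>m\<in>{p..a}. width ord m = b)"
  have "?P a" by (simp add: b_def)
  then obtain p where p: "?P p" "\<And>r. ?P r \<Longrightarrow> p \<le> r"
    using LeastI[of ?P a] Least_le[of ?P] by blast
  have up: "width ord q < width ord (q + 1)" if "q < card V"
  proof -
    have "\<not> ?Q (q + 1)" using q(2)[of "q + 1"] by auto
    then have "width ord (q + 1) \<noteq> b" using q(1) that by (auto simp: le_Suc_eq)
    moreover have "b \<le> width ord (q + 1)"
      using pinch_cluster_leaves_upwards[OF ord pinch] q(1) that unfolding b_def by blast
    ultimately show ?thesis using q(1) by auto
  qed
  have down: "width ord p < width ord (p - 1)" if "0 < p"
  proof -
    have "\<not> ?P (p - 1)" using p(2)[of "p - 1"] that by fastforce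
    moreover have "m = p - 1 \<or> m \<in> {p..a}" if "m \<in> {p - 1..a}" for m
      using that by auto
    ultimately have "width ord (p - 1) \<noteq> b"
      using p(1) by (metis diff_le_self order_trans)
    moreover have "b \<le> width ord (p - 1)"
      using pinch_cluster_leaves_downwards[OF ord pinch] p(1) that a unfolding b_def by blast
    ultimately show ?thesis using p(1) by auto
  qed
  have const: "width ord m = b" if "p \<le> m" "m \<le> q" for m
    using that p(1) q(1) by (cases "m \<le> a") auto
  have "p \<le> q" using p(1) q(1) by linarith
  then have "min_flat ord p q"
    using up down const q(1) unfolding min_flat_def flat_def by fastforce
  then show ?thesis using p(1) q(1) unfolding local_min_def by blast
qed

subsection \<open>Complexity of an ordering\<close>

text \<open>Widths are reals, but \<open>V\<close> has finitely many subsets, so only finitely many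
  widths occur. Counting the subsets of smaller boundary embeds these widths into the naturals in
  the same order.\<close>

definition rank :: "real \<Rightarrow> nat" where
  "rank x = card {B \<in> Pow V. boundary_size B < x}"

text \<open>The set \<open>B\<close> itself is counted on the right but not on the left, which makes
  the inequality strict.\<close>

lemma rank_less: "B \<subseteq> V \<Longrightarrow> boundary_size B < y \<Longrightarrow> rank (boundary_size B) < rank y"
  unfolding rank_def using finite_V by (intro psubset_card_mono) auto

text \<open>
  With base above the number of levels, comparing these sums is comparing the multisets of
  widths.
\<close>

definition complexity :: "('v \<Rightarrow> nat) \<Rightarrow> nat" where
  "complexity ord = (\<Sum>m\<le>card V. (card V + 2) ^ rank (width ord m))"

text \<open>Every new width in the window from \<open>p\<close> to \<open>q\<close> ranks below the
  highest old rank \<open>R\<close> there. With \<open>?K = card V + 2\<close>, the new terms are at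
  most \<open>?K ^ (R - 1)\<close> each and too few to reach the single old term
  \<open>?K ^ R\<close>. The level \<open>l\<close> may thus differ from \<open>m\<close>.\<close>

lemma complexity_less:
  assumes ord': "ordering ord'" and pq: "p \<le> q" "q \<le> card V"
    and same: "\<And>m. m < p \<or> q < m \<Longrightarrow> m \<le> card V \<Longrightarrow> width ord' m = width ord m"
    and less: "\<And>m. p \<le> m \<Longrightarrow> m \<le> q \<Longrightarrow> \<exists>l\<in>{p..q}. width ord' m < width ord l"
  shows "complexity ord' < complexity ord"
proof -
  let ?K = "card V + 2"
  let ?f = "\<lambda>ord m. ?K ^ rank (width ord m)"
  obtain M where M: "M \<in> {p..q}" "\<And>l. l \<in> {p..q} \<Longrightarrow> rank (width ord l) \<le> rank (width ord M)"
  proof -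
    let ?X = "(\<lambda>l. rank (width ord l)) ` {p..q}"
    have "Max ?X \<in> ?X" using pq by (intro Max_in) auto
    then obtain M where "M \<in> {p..q}" "Max ?X = rank (width ord M)" by blast
    then show thesis using that Max_ge[of ?X] by fastforce
  qed
  define R where "R = rank (width ord M)"
  have lower: "rank (width ord' m) < R" if m: "m \<in> {p..q}" for m
  proof -
    obtain l where "l \<in> {p..q}" "width ord' m < width ord l" using less[of m] m by auto
    moreover have "initial ord' m \<subseteq> V" using initial_subset[OF ord'] m pq by auto
    ultimately show ?thesis
      using rank_less M(2) unfolding R_def width_def by (meson less_le_trans)
  qed
  \<comment> \<open>A rank strictly below \<open>R\<close> exists, so the natural subtraction in
    \<open>R - 1\<close> does not truncate.\<close>
  then have "0 < R" using M(1) by fastforce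
  have "(\<Sum>m\<in>{p..q}. ?f ord' m) \<le> (\<Sum>m\<in>{p..q}. ?K ^ (R - 1))"
  proof (intro sum_mono power_increasing)
    fix m assume "m \<in> {p..q}"
    then show "rank (width ord' m) \<le> R - 1" using lower by fastforce
  qed simp
  also have "\<dots> = (q + 1 - p) * ?K ^ (R - 1)" by simp
  \<comment> \<open>The choice of base enters here: the window has at most \<open>card V + 1\<close>
    levels.\<close>
  also have "\<dots> < ?K * ?K ^ (R - 1)"
    using pq by (intro mult_strict_right_mono) auto
  also have "\<dots> = ?f ord M" using \<open>0 < R\<close> by (simp add: R_def flip: power_Suc)
  also have "\<dots> \<le> (\<Sum>m\<in>{p..q}. ?f ord m)" using M(1) by (intro member_le_sum) auto
  finally have inside: "(\<Sum>m\<in>{p..q}. ?f ord' m) < (\<Sum>m\<in>{p..q}. ?f ord m)" .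
  have "(\<Sum>m\<in>{..card V} - {p..q}. ?f ord' m) = (\<Sum>m\<in>{..card V} - {p..q}. ?f ord m)"
    by (intro sum.cong refl) (use same in \<open>auto simp: not_le\<close>)
  moreover have "complexity r = (\<Sum>m\<in>{..card V} - {p..q}. ?f r m) + (\<Sum>m\<in>{p..q}. ?f r m)" for r
    unfolding complexity_def using pq by (intro sum.subset_diff) auto
  ultimately show ?thesis using inside by simp
qed

subsection \<open>Weak reductions\<close>

lemma ordering_comp:
  assumes "ordering ord" "inj_on f {1..card V}" "f ` {1..card V} \<subseteq> {1..card V}"
  shows "ordering (f \<circ> ord)"
proof -
  have "bij_betw f {1..card V} {1..card V}"
    using endo_inj_surj[of "{1..card V}" f] assms(2,3) by (auto simp: bij_betw_def)
  then show ?thesis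
    using assms(1) unfolding ordering_def by (rule bij_betw_trans[rotated])
qed

text \<open>Move the vertex \<open>?v\<close> from position \<open>k\<close> to just after the
  vertex at position \<open>i + 1\<close>. A changed level \<open>m\<close> then carries the old
  segment at \<open>m + 1\<close> without \<open>?v\<close>. For \<open>m < i\<close> the slope of
  \<open>?v\<close> there is at least \<open>level_slope ord i k > 0\<close>, so the new width is
  below the old one at \<open>m + 1\<close>. For \<open>m = i\<close> the second slope condition is
  exactly the drop below the old width at \<open>i\<close>.\<close>

lemma move_vertex_later:
  assumes ord: "ordering ord" and k: "1 \<le> k" "k \<le> i" "i < card V"
    and slope: "level_slope ord i k > 0"
      "level_slope ord i k - level_slope ord i (i + 1) - 2 * level_weight ord k (i + 1) > 0"
  shows "\<exists>ord'. ordering ord' \<and> complexity ord' < complexity ord \<and>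
    (\<forall>m\<le>card V. m < k \<or> i < m \<longrightarrow> initial ord' m = initial ord m)"
proof -
  let ?v = "vert ord k"
  \<comment> \<open>A cyclic shift of the positions \<open>k\<close> to
    \<open>i + 1\<close>.\<close>
  define f where "f n = (if n = k then i + 1 else if k < n \<and> n \<le> i + 1 then n - 1 else n)" for n
  define ord' where "ord' = f \<circ> ord"
  have ord': "ordering ord'"
    unfolding ord'_def using k
    by (intro ordering_comp ord) (auto simp: f_def inj_on_def split: if_splits)
  have ord'_apply: "ord' x = f (ord x)" for x by (simp add: ord'_def)
  have vV: "?v \<in> V" using vert_in[OF ord] k by simp
  have v_in: "?v \<in> initial ord m" if "k \<le> m" "m \<le> card V" for m
    using that k vV by (simp add: initial_eq[OF ord] ord_vert[OF ord])
  have outside: "initial ord' m = initial ord m" if "m < k \<or> i < m" "m \<le> card V" for m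
    using that k
    by (auto simp: initial_eq[OF ord] initial_eq[OF ord'] ord'_apply f_def split: if_splits)
  have inside: "initial ord' m = initial ord (m + 1) - {?v}" if "k \<le> m" "m \<le> i" for m
  proof -
    have "x \<in> initial ord' m \<longleftrightarrow> x \<in> initial ord (m + 1) \<and> x \<noteq> ?v" for x
    proof (cases "x \<in> V \<and> ord x \<noteq> k")
      case True
      then have "x \<noteq> ?v" using ord_vert[OF ord] k by auto
      then show ?thesis
        using True that k
        by (auto simp: initial_eq[OF ord] initial_eq[OF ord'] ord'_apply f_def)
    next
      case False
      then have "x \<notin> V \<or> x = ?v" "ord ?v = k"
        using ord_eq_iff[OF ord] ord_vert[OF ord] k by auto
      then show ?thesis
        using that k vV
        by (auto simp: initial_eq[OF ord] initial_eq[OF ord'] ord'_apply f_def)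
    qed
    then show ?thesis by blast
  qed
  have removed: "width ord' m = width ord (m + 1) - slope (initial ord (m + 1)) ?v"
    if "k \<le> m" "m \<le> i" for m
    using boundary_size_remove[OF v_in[of "m + 1"]] initial_subset[OF ord, of "m + 1"]
      inside that k by (simp add: width_def)
  have "complexity ord' < complexity ord"
  proof (rule complexity_less[OF ord' \<open>k \<le> i\<close>])
    show "i \<le> card V" using k by simp
    show "width ord' m = width ord m" if "m < k \<or> i < m" "m \<le> card V" for m
      using outside[OF that] by (simp add: width_def)
    fix m assume m: "k \<le> m" "m \<le> i"
    show "\<exists>l\<in>{k..i}. width ord' m < width ord l"
    proof (cases "m = i")
      case False
      have "slope (initial ord i) ?v \<le> slope (initial ord (m + 1)) ?v"
        using False m k by (intro slope_antimono initial_mono initial_subset[OF ord]) auto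
      then have "width ord' m < width ord (m + 1)"
        using removed[OF m] slope(1) by (simp add: level_slope_def)
      then show ?thesis using False m by (intro bexI[of _ "m + 1"]) auto
    next
      case True
      let ?u = "vert ord (i + 1)"
      have u: "?u \<in> V - initial ord i" "initial ord i \<subseteq> V"
        using k vert_in[OF ord] ord_vert[OF ord] by (simp_all add: initial_eq[OF ord])
      have "width ord (i + 1) = width ord i + slope (initial ord i) ?u"
        using boundary_size_insert[OF u] by (simp add: width_def initial_Suc)
      moreover have "slope (initial ord (i + 1)) ?v
          = slope (initial ord i) ?v - 2 * edge_weight ?v ?u"
        using slope_insert[OF u] by (simp add: initial_Suc)
      ultimately have "width ord' m < width ord i"
        using removed[OF m] slope(2) True by (simp add: level_slope_def level_weight_def)
      then show ?thesis using k by (intro bexI[of _ i]) auto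
    qed
  qed
  then show ?thesis using ord' outside by blast
qed

text \<open>The mirror image: \<open>?v\<close> moves from position \<open>k\<close> to just before
  the vertex at position \<open>j\<close>, and a changed level \<open>m\<close> carries the old
  segment at \<open>m - 1\<close> with \<open>?v\<close> added. For \<open>m > j\<close> the slope
  of \<open>?v\<close> is at most \<open>level_slope ord j k < 0\<close>, so the new width is below
  the old one at \<open>m - 1\<close>. For \<open>m = j\<close> the second slope condition gives the
  drop below the old width at \<open>j\<close>.\<close>

lemma move_vertex_earlier:
  assumes ord: "ordering ord" and k: "1 \<le> j" "j < k" "k \<le> card V"
    and slope: "level_slope ord j k < 0"
      "- level_slope ord j k + level_slope ord j j - 2 * level_weight ord k j > 0"
  shows "\<exists>ord'. ordering ord' \<and> complexity ord' < complexity ord \<and>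
    (\<forall>m\<le>card V. m < j \<or> k \<le> m \<longrightarrow> initial ord' m = initial ord m)"
proof -
  let ?v = "vert ord k"
  define f where "f n = (if n = k then j else if j \<le> n \<and> n < k then n + 1 else n)" for n
  define ord' where "ord' = f \<circ> ord"
  have ord': "ordering ord'"
    unfolding ord'_def using k
    by (intro ordering_comp ord) (auto simp: f_def inj_on_def split: if_splits)
  have ord'_apply: "ord' x = f (ord x)" for x by (simp add: ord'_def)
  have vV: "?v \<in> V" using vert_in[OF ord] k by simp
  have v_notin: "?v \<in> V - initial ord m" if "m < k" for m
    using that k vV by (simp add: initial_eq[OF ord] ord_vert[OF ord])
  have outside: "initial ord' m = initial ord m" if "m < j \<or> k \<le> m" "m \<le> card V" for m
    using that k
    by (auto simp: initial_eq[OF ord] initial_eq[OF ord'] ord'_apply f_def split: if_splits)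
  have inside: "initial ord' m = insert ?v (initial ord (m - 1))" if "j \<le> m" "m < k" for m
  proof -
    have "x \<in> initial ord' m \<longleftrightarrow> x = ?v \<or> x \<in> initial ord (m - 1)" for x
    proof (cases "x \<in> V \<and> ord x \<noteq> k")
      case True
      then have "x \<noteq> ?v" using ord_vert[OF ord] k by auto
      then show ?thesis
        using True that k
        by (auto simp: initial_eq[OF ord] initial_eq[OF ord'] ord'_apply f_def)
    next
      case False
      then have "x \<notin> V \<or> x = ?v" "ord ?v = k"
        using ord_eq_iff[OF ord] ord_vert[OF ord] k by auto
      then show ?thesis
        using that k vV
        by (auto simp: initial_eq[OF ord] initial_eq[OF ord'] ord'_apply f_def)
    qed
    then show ?thesis by blast
  qed
  have added: "width ord' m = width ord (m - 1) + slope (initial ord (m - 1)) ?v"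
    if "j \<le> m" "m < k" for m
    using boundary_size_insert[OF v_notin[of "m - 1"]] initial_subset[OF ord, of "m - 1"]
      inside that k by (simp add: width_def)
  have "complexity ord' < complexity ord"
  proof (rule complexity_less[OF ord', of j "k - 1"])
    show "j \<le> k - 1" "k - 1 \<le> card V" using k by auto
    show "width ord' m = width ord m" if "m < j \<or> k - 1 < m" "m \<le> card V" for m
    proof -
      have "m < j \<or> k \<le> m" using that(1) by linarith
      then show ?thesis using outside that(2) by (simp add: width_def)
    qed
    fix m assume m': "j \<le> m" "m \<le> k - 1"
    then have m: "j \<le> m" "m < k" using k by auto
    show "\<exists>l\<in>{j..k - 1}. width ord' m < width ord l"
    proof (cases "m = j")
      case False
      have "slope (initial ord (m - 1)) ?v \<le> slope (initial ord j) ?v"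
        using False m k by (intro slope_antimono initial_mono initial_subset[OF ord]) auto
      then have "width ord' m < width ord (m - 1)"
        using added[OF m] slope(1) by (simp add: level_slope_def)
      then show ?thesis using False m by (intro bexI[of _ "m - 1"]) auto
    next
      case True
      let ?u = "vert ord j"
      have u: "?u \<in> V - initial ord (j - 1)" "initial ord (j - 1) \<subseteq> V"
        using k vert_in[OF ord] ord_vert[OF ord] by (simp_all add: initial_eq[OF ord])
      have j: "initial ord j = insert ?u (initial ord (j - 1))"
        using initial_Suc[of ord "j - 1"] k by simp
      \<comment> \<open>The step from level \<open>j - 1\<close> to \<open>j\<close> is the slope of
        \<open>?u\<close> at \<open>j - 1\<close>. By \<open>slope_insert_self\<close> it equals the
        slope at \<open>j\<close>, which is the form occurring in the hypothesis.\<close>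
      have "width ord j = width ord (j - 1) + slope (initial ord j) ?u"
        using boundary_size_insert[OF u] slope_insert_self[OF u] by (simp add: width_def j)
      moreover have "slope (initial ord j) ?v
          = slope (initial ord (j - 1)) ?v - 2 * edge_weight ?v ?u"
        using slope_insert[OF u] by (simp add: j)
      ultimately have "width ord' m < width ord j"
        using added[OF m] slope(2) True by (simp add: level_slope_def level_weight_def)
      then show ?thesis using k by (intro bexI[of _ j]) auto
    qed
  qed
  then show ?thesis using ord' outside by blast
qed

text \<open>The levels changed by the move run from \<open>k\<close> to \<open>i\<close>, or from
  \<open>j\<close> to \<open>k - 1\<close>. Both ranges lie strictly between the flanking minima
  \<open>jm\<close> and \<open>ip\<close>, where no local minimum occurs, so the segment at
  \<open>a\<close> survives.\<close>

lemma weakly_reducible_reduce: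
  assumes ord: "ordering ord" and red: "weakly_reducible ord i j"
    and a: "local_min ord a" "a \<le> card V"
  shows "\<exists>ord'. ordering ord' \<and> complexity ord' < complexity ord \<and> initial ord' a = initial ord a"
proof -
  obtain im jm ip jp k where
    flat: "max_flat ord i j" and flank: "flanking_minima ord i j im jm ip jp"
    and k: "jm < k" "k \<le> ip"
    and alt: "k \<le> i \<and> level_slope ord i k > 0 \<and>
        level_slope ord i k - level_slope ord i (i + 1) - 2 * level_weight ord k (i + 1) > 0 \<or>
      k > j \<and> level_slope ord j k < 0 \<and>
        - level_slope ord j k + level_slope ord j j - 2 * level_weight ord k j > 0"
    using red unfolding weakly_reducible_def by blast
  have ij: "0 < i" "i \<le> j" "j < card V" using flat unfolding max_flat_def flat_def by blast+
  have min: "min_flat ord ip jp" and jm: "jm < i" "j < ip" and "\<not> (jm < a \<and> a < ip)"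
    using flank a(1) unfolding flanking_minima_def by blast+
  then have apart: "a \<le> jm \<or> ip \<le> a" by linarith
  have "ip \<le> jp" "jp \<le> card V" using min unfolding min_flat_def flat_def by blast+
  then have kV: "1 \<le> k" "k \<le> card V" and j1: "1 \<le> j" using k ij by linarith+
  from alt show ?thesis
  proof (elim disjE conjE)
    assume le: "k \<le> i"
      and slope: "level_slope ord i k > 0"
        "level_slope ord i k - level_slope ord i (i + 1) - 2 * level_weight ord k (i + 1) > 0"
    have "i < card V" using ij by linarith
    then obtain ord' where "ordering ord'" "complexity ord' < complexity ord"
      "\<forall>m\<le>card V. m < k \<or> i < m \<longrightarrow> initial ord' m = initial ord m"
      using move_vertex_later[OF ord kV(1) le _ slope] by blast
    moreover have "a < k \<or> i < a" using apart k jm ij le by linarith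
    ultimately show ?thesis using a(2) by blast
  next
    assume le: "j < k"
      and slope: "level_slope ord j k < 0"
        "- level_slope ord j k + level_slope ord j j - 2 * level_weight ord k j > 0"
    obtain ord' where "ordering ord'" "complexity ord' < complexity ord"
      "\<forall>m\<le>card V. m < j \<or> k \<le> m \<longrightarrow> initial ord' m = initial ord m"
      using move_vertex_earlier[OF ord j1 le kV(2) slope] by blast
    moreover have "a < j \<or> k \<le> a" using apart k jm ij le by linarith
    ultimately show ?thesis using a(2) by blast
  qed
qed

lemma pinch_cluster_discovered:
  assumes pinch: "pinch_cluster A"
  shows "\<exists>ord. ordering ord \<and> strongly_irreducible ord \<and> discovers ord A"
proof -
  let ?a = "card A"
  let ?through = "\<lambda>ord. ordering ord \<and> initial ord ?a = A"
  have "A \<subseteq> V" using pinch by (simp add: pinch_cluster_def)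
  then have a: "?a \<le> card V" using finite_V by (rule card_mono[rotated])
  have "\<exists>ord0. ?through ord0" by (rule ordering_through_exists[OF \<open>A \<subseteq> V\<close>])
  \<comment> \<open>\<open>complexity\<close> takes natural values, so a minimiser exists among the
    orderings through \<open>A\<close>.\<close>
  then obtain ord where "?through ord"
    and least: "\<And>ord'. ?through ord' \<Longrightarrow> complexity ord \<le> complexity ord'"
    using ex_has_least_nat[of ?through _ complexity] by blast
  then have ord: "ordering ord" "initial ord ?a = A" by blast+
  have "pinch_cluster (initial ord ?a)" using pinch by (simp only: ord(2))
  then have min: "local_min ord ?a" by (rule pinch_cluster_local_min[OF ord(1) _ a])
  have "strongly_irreducible ord"
    unfolding strongly_irreducible_def
  proof (intro allI impI notI)
    fix i j assume "weakly_reducible ord i j"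
    then obtain ord' where "ordering ord'" "complexity ord' < complexity ord"
        "initial ord' ?a = initial ord ?a"
      using weakly_reducible_reduce[OF ord(1) _ min a] by blast
    \<comment> \<open>The reduced ordering still has \<open>A\<close> as its segment at level
      \<open>?a\<close>, so it competes with the minimiser and beats it.\<close>
    then show False using least[of ord'] ord(2) by (metis not_less)
  qed
  moreover have "discovers ord A" using min ord unfolding discovers_def by blast
  ultimately show ?thesis using ord by blast
qed

end

theorem lemma9:
  fixes V :: "'v set" and E :: "'v set set" and w :: "'v set \<Rightarrow> real" and A :: "'v set"
  assumes "weighted_graph V E w"
    and "weighted_graph.pinch_cluster V E w A"
  shows "\<exists>ord. weighted_graph.ordering V ord \<and>
               weighted_graph.strongly_irreducible V E w ord \<and>
               weighted_graph.discovers V E w ord A"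
  by (rule weighted_graph.pinch_cluster_discovered[OF assms])

end
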